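(* Suppose there exists a $(k,\ell_1,\ell_2)$-distribution design on $m$ points, having $b$ blocks of size $d$, and suppose that $Q$ is a prime power with $Q\ge m+1$. Suppose that this design contains a basic repairing set of size $s$. Then, for any $n$ such that $s\le n\le b$, there is a $(k,n,d)$-RTS with restricted repairability, having information rate $(\ell_2-\ell_1)/d$ and communication complexity $d/(\ell_2-\ell_1)$, where every share is an element of $(\mathbb{F}_Q)^d$.
   Context: Distribution designs. A design consists of a finite set $X$ of $m$ points and a collection of blocks, each a $d$-element subset of $X$. For an integer $k\ge 2$ not exceeding the number of blocks, and integers $\ell_1,\ell_2$ with $\ell_2-\ell_1\ge 1$, it is a $(k,\ell_1,\ell_2)$-distribution design if the union of any $k$ blocks contains at least $\ell_2$ points and the union of any $k-1$ blocks contains at most $\ell_1$ points. A basic repairing set of size $s$ is a subset of $s$ of the blocks such that every point of the design is contained in at least two blocks of the subset. Threshold schemes. For $2\le k\le n$, a $(k,n)$-threshold scheme is a (randomized) method by which a dealer chooses a secret from a finite set $\mathcal{K}$ and gives a share, from a finite set $\mathcal{S}$ of possible shares, to each of $n$ players $P_1,\dots,P_n$, such that any $k$ players can compute the secret from their shares, and no $k-1$ players obtain any information about the secret (unconditionally: the distribution of their shares does not depend on the secret). Its information rate is $\log_2|\mathcal{K}|/\log_2|\mathcal{S}|$. Repairing. A repairing protocol lets a player $P_\ell$ who lost their share recover exactly that share, without the dealer, with help from a set of other players, over secure pairwise channels. It has two phases. In the message exchange phase (possibly empty) each of the helping players, using their own share and private randomness, simultaneously sends at most one message to each other helping player. In the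 repairing phase the helping players each send a message to $P_\ell$ (depending on their share, randomness and the messages received), from which $P_\ell$ computes the lost share. Security: all players follow the protocol honestly, and for every coalition of $k-1$ players (which may or may not include $P_\ell$), the shares of the coalition together with all messages its members sent or received in the execution of the protocol give no information about the secret. A $(k,n)$-threshold scheme with such a secure protocol with repairing degree $d$ is a $(k,n,d)$-RTS (repairable threshold scheme). It has restricted repairability if for every player there exists a set of at most $d$ other players who can repair that player's share. The communication complexity of a repairing protocol is the sum of the bit-lengths of all messages transmitted divided by the bit-length of the secret (an element of a set of size $N$ has bit-length $\log_2 N$). *)

theory Defs
  imports
    "HOL-Probability.Product_PMF"
    "HOL-Number_Theory.Prime_Powers"
begin

section \<open>Distribution designs\<close>

text \<open>
  The blocks are the family \<open>B 0, \<dots>, B (b - 1)\<close>, and a choice of \<open>j\<close> blocks is a set of \<open>j\<close>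
  indices, so repeated blocks are not excluded a priori.
\<close>

definition design :: "'p set \<Rightarrow> (nat \<Rightarrow> 'p set) \<Rightarrow> nat \<Rightarrow> nat \<Rightarrow> bool" where
  "design X B b d \<longleftrightarrow> finite X \<and> (\<forall>i<b. B i \<subseteq> X \<and> card (B i) = d)"

definition distribution_design ::
    "nat \<Rightarrow> int \<Rightarrow> int \<Rightarrow> 'p set \<Rightarrow> (nat \<Rightarrow> 'p set) \<Rightarrow> nat \<Rightarrow> nat \<Rightarrow> bool" where
  "distribution_design k l1 l2 X B b d \<longleftrightarrow>
     design X B b d \<and> 2 \<le> k \<and> k \<le> b \<and> l2 - l1 \<ge> 1 \<and>
     (\<forall>I \<subseteq> {..<b}. card I = k \<longrightarrow> int (card (\<Union>i\<in>I. B i)) \<ge> l2) \<and>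
     (\<forall>I \<subseteq> {..<b}. card I = k - 1 \<longrightarrow> int (card (\<Union>i\<in>I. B i)) \<le> l1)"

definition basic_repairing_set ::
    "'p set \<Rightarrow> (nat \<Rightarrow> 'p set) \<Rightarrow> nat \<Rightarrow> nat \<Rightarrow> nat set \<Rightarrow> bool" where
  "basic_repairing_set X B b s I \<longleftrightarrow>
     I \<subseteq> {..<b} \<and> card I = s \<and> (\<forall>x\<in>X. card {i\<in>I. x \<in> B i} \<ge> 2)"

section \<open>Threshold schemes\<close>

text \<open>
  The players are \<open>0, \<dots>, n - 1\<close>. The distribution \<open>deal s\<close> is that of the vector of shares when the
  secret is \<open>s\<close>. No distribution is put on the secrets: that some data give no information about
  the secret means that the conditional distribution of the data is the same for all secrets.
\<close>

definition threshold_scheme ::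
    "nat \<Rightarrow> nat \<Rightarrow> 'k set \<Rightarrow> 's set \<Rightarrow> ('k \<Rightarrow> (nat \<Rightarrow> 's) pmf) \<Rightarrow> bool" where
  "threshold_scheme k n K S deal \<longleftrightarrow>
     2 \<le> k \<and> k \<le> n \<and> finite K \<and> K \<noteq> {} \<and> finite S \<and>
     (\<forall>s\<in>K. \<forall>\<sigma>\<in>set_pmf (deal s). \<forall>i<n. \<sigma> i \<in> S) \<and>
     (\<forall>A \<subseteq> {..<n}. card A = k \<longrightarrow>
        (\<exists>rec. \<forall>s\<in>K. \<forall>\<sigma>\<in>set_pmf (deal s). rec (restrict \<sigma> A) = s)) \<and>
     (\<forall>A \<subseteq> {..<n}. card A = k - 1 \<longrightarrow>
        (\<forall>s\<in>K. \<forall>s'\<in>K. map_pmf (\<lambda>\<sigma>. restrict \<sigma> A) (deal s) = map_pmf (\<lambda>\<sigma>. restrict \<sigma> A) (deal s')))"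

definition information_rate :: "'k set \<Rightarrow> 's set \<Rightarrow> real" where
  "information_rate K S = log 2 (real (card K)) / log 2 (real (card S))"

section \<open>Repairing protocols\<close>

text \<open>
  \<open>exch_pairs\<close> is the set of pairs (sender, receiver) that are active in the message exchange phase.
  It is part of the protocol and does not depend on shares or coins, so that the absence of a
  message carries no information. \<open>exch_msg p i j x c\<close> is the message that helper \<open>i\<close>, holding share
  \<open>x\<close> and coins \<open>c\<close>, sends to helper \<open>j\<close>; since it does not depend on other messages, the exchange is
  simultaneous. \<open>rep_msg p i x c w\<close> is the message of helper \<open>i\<close> to the repaired player, where \<open>w j\<close>
  is the message received from \<open>j\<close>.
\<close>

record ('s, 'c, 'm) repair_protocol =
  helpers :: "nat set"
  coins :: "nat \<Rightarrow> 'c pmf"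
  exch_pairs :: "(nat \<times> nat) set"
  exch_msg :: "nat \<Rightarrow> nat \<Rightarrow> 's \<Rightarrow> 'c \<Rightarrow> 'm"
  rep_msg :: "nat \<Rightarrow> 's \<Rightarrow> 'c \<Rightarrow> (nat \<Rightarrow> 'm) \<Rightarrow> 'm"
  recover :: "(nat \<Rightarrow> 'm) \<Rightarrow> 's"

text \<open>All transcripts are functions of the shares \<open>\<sigma>\<close> of the players and the coins \<open>r\<close> of the helpers.\<close>

definition exch_transcript ::
    "('s, 'c, 'm) repair_protocol \<Rightarrow> (nat \<Rightarrow> 's) \<Rightarrow> (nat \<Rightarrow> 'c) \<Rightarrow> nat \<times> nat \<Rightarrow> 'm" where
  "exch_transcript p \<sigma> r = restrict (\<lambda>(i, j). exch_msg p i j (\<sigma> i) (r i)) (exch_pairs p)"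

definition received ::
    "('s, 'c, 'm) repair_protocol \<Rightarrow> (nat \<Rightarrow> 's) \<Rightarrow> (nat \<Rightarrow> 'c) \<Rightarrow> nat \<Rightarrow> nat \<Rightarrow> 'm" where
  "received p \<sigma> r i = restrict (\<lambda>j. exch_transcript p \<sigma> r (j, i)) {j. (j, i) \<in> exch_pairs p}"

definition rep_transcript ::
    "('s, 'c, 'm) repair_protocol \<Rightarrow> (nat \<Rightarrow> 's) \<Rightarrow> (nat \<Rightarrow> 'c) \<Rightarrow> nat \<Rightarrow> 'm" where
  "rep_transcript p \<sigma> r = restrict (\<lambda>i. rep_msg p i (\<sigma> i) (r i) (received p \<sigma> r i)) (helpers p)"

text \<open>
  The shares, together with independent coins for the helpers, when the secret is \<open>s\<close>.
\<close>

definition execution ::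
    "('k \<Rightarrow> (nat \<Rightarrow> 's) pmf) \<Rightarrow> ('s, 'c, 'm) repair_protocol \<Rightarrow> 'k \<Rightarrow>
       ((nat \<Rightarrow> 's) \<times> (nat \<Rightarrow> 'c)) pmf" where
  "execution deal p s = pair_pmf (deal s) (Pi_pmf (helpers p) undefined (coins p))"

text \<open>
  The view of a coalition \<open>C\<close> when the share of player \<open>l\<close> is repaired: the shares of \<open>C\<close> and all
  messages sent or received by members of \<open>C\<close>.
\<close>

definition view ::
    "('s, 'c, 'm) repair_protocol \<Rightarrow> nat \<Rightarrow> nat set \<Rightarrow> (nat \<Rightarrow> 's) \<times> (nat \<Rightarrow> 'c) \<Rightarrow>
       (nat \<Rightarrow> 's) \<times> (nat \<times> nat \<Rightarrow> 'm) \<times> (nat \<Rightarrow> 'm)" where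
  "view p l C = (\<lambda>(\<sigma>, r).
     (restrict \<sigma> C,
      restrict (exch_transcript p \<sigma> r) {(i, j) \<in> exch_pairs p. i \<in> C \<or> j \<in> C},
      restrict (rep_transcript p \<sigma> r) {i \<in> helpers p. i \<in> C \<or> l \<in> C}))"

text \<open>
  The sets of messages that can occur on a given channel. The bit-length of a message is measured
  with respect to these sets, so no communication complexity can be obtained by padding.
\<close>

definition exch_space ::
    "'k set \<Rightarrow> ('k \<Rightarrow> (nat \<Rightarrow> 's) pmf) \<Rightarrow> ('s, 'c, 'm) repair_protocol \<Rightarrow> nat \<times> nat \<Rightarrow> 'm set" where
  "exch_space K deal p e =
     (\<Union>s\<in>K. (\<lambda>(\<sigma>, r). exch_transcript p \<sigma> r e) ` set_pmf (execution deal p s))"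

definition rep_space ::
    "'k set \<Rightarrow> ('k \<Rightarrow> (nat \<Rightarrow> 's) pmf) \<Rightarrow> ('s, 'c, 'm) repair_protocol \<Rightarrow> nat \<Rightarrow> 'm set" where
  "rep_space K deal p i =
     (\<Union>s\<in>K. (\<lambda>(\<sigma>, r). rep_transcript p \<sigma> r i) ` set_pmf (execution deal p s))"

definition secure_repair_protocol ::
    "nat \<Rightarrow> nat \<Rightarrow> 'k set \<Rightarrow> ('k \<Rightarrow> (nat \<Rightarrow> 's) pmf) \<Rightarrow> nat \<Rightarrow> ('s, 'c, 'm) repair_protocol \<Rightarrow> bool" where
  "secure_repair_protocol k n K deal l p \<longleftrightarrow>
     helpers p \<subseteq> {..<n} - {l} \<and>
     exch_pairs p \<subseteq> {(i, j). i \<in> helpers p \<and> j \<in> helpers p \<and> i \<noteq> j} \<and>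
     (\<forall>e \<in> exch_pairs p. finite (exch_space K deal p e)) \<and>
     (\<forall>i \<in> helpers p. finite (rep_space K deal p i)) \<and>
     (\<forall>s\<in>K. \<forall>(\<sigma>, r) \<in> set_pmf (execution deal p s). recover p (rep_transcript p \<sigma> r) = \<sigma> l) \<and>
     (\<forall>C \<subseteq> {..<n}. card C = k - 1 \<longrightarrow>
        (\<forall>s\<in>K. \<forall>s'\<in>K. map_pmf (view p l C) (execution deal p s)
                     = map_pmf (view p l C) (execution deal p s')))"

definition communication_complexity ::
    "'k set \<Rightarrow> ('k \<Rightarrow> (nat \<Rightarrow> 's) pmf) \<Rightarrow> ('s, 'c, 'm) repair_protocol \<Rightarrow> real" where
  "communication_complexity K deal p =
     ((\<Sum>e\<in>exch_pairs p. log 2 (real (card (exch_space K deal p e)))) +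
      (\<Sum>i\<in>helpers p. log 2 (real (card (rep_space K deal p i)))))
     / log 2 (real (card K))"

text \<open>
  A \<open>(k, n, d)\<close>-RTS with restricted repairability; \<open>P l\<close> is the protocol that repairs the share of
  player \<open>l\<close>.
\<close>

definition restricted_RTS ::
    "nat \<Rightarrow> nat \<Rightarrow> nat \<Rightarrow> 'k set \<Rightarrow> 's set \<Rightarrow> ('k \<Rightarrow> (nat \<Rightarrow> 's) pmf) \<Rightarrow>
       (nat \<Rightarrow> ('s, 'c, 'm) repair_protocol) \<Rightarrow> bool" where
  "restricted_RTS k n d K S deal P \<longleftrightarrow>
     threshold_scheme k n K S deal \<and>
     (\<forall>l<n. secure_repair_protocol k n K deal l (P l) \<and> card (helpers (P l)) \<le> d)"

end

theory Submission
  imports Defs "HOL-Computational_Algebra.Polynomial"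
begin

text \<open>
  Each point of the design gets a nonzero element \<open>a\<close> of the field and carries the value \<open>f a\<close> of
  \<open>f = s + x\<^sup>t r\<close>, where \<open>t = l2 - l1\<close>, the coefficients of \<open>s\<close> are the secret, and \<open>r\<close> is a random
  polynomial of degree less than \<open>l1\<close>. The share of a player lists the values at the points of their
  block. Any \<open>l2\<close> values determine \<open>f\<close>. For at most \<open>l1\<close> points, a change of the secret is
  compensated by adding to \<open>r\<close> the polynomial that interpolates \<open>(s - s') / x\<^sup>t\<close>, so these values
  carry no information. A lost value is sent by another player whose block contains the point. All
  that a coalition sees is then a function of its own shares, so that no message exchange phase is
  needed.
\<close>

section \<open>Interpolation and counting over a finite field\<close>

lemma interpolation_exists:
  fixes v :: "'a::field \<Rightarrow> 'a"
  assumes "finite E"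
  shows "\<exists>p. degree p \<le> card E - 1 \<and> (\<forall>x\<in>E. poly p x = v x)"
  using assms
proof (induction E)
  case empty
  show ?case by (intro exI[of _ 0]) auto
next
  case (insert e E)
  then obtain p where p: "degree p \<le> card E - 1" "\<And>x. x \<in> E \<Longrightarrow> poly p x = v x" by blast
  \<comment> \<open>Newton's form: \<open>q\<close> vanishes on \<open>E\<close> but not at
    \<open>e\<close>, so adding a multiple of it corrects the value at \<open>e\<close> and keeps
    the others.\<close>
  define q where "q = (\<Prod>a\<in>E. [:-a, 1:])"
  have "degree q \<le> card E"
    unfolding q_def by (rule order.trans[OF degree_prod_sum_le]) (use insert in auto)
  moreover have "poly q x = 0" if "x \<in> E" for x
    using that insert by (auto simp: q_def poly_prod)
  moreover have "poly q e \<noteq> 0"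
    using insert by (auto simp: q_def poly_prod)
  ultimately show ?case
    using insert p
    by (intro exI[of _ "p + smult ((v e - poly p e) / poly q e) q"])
       (auto intro!: degree_add_le order.trans[OF degree_smult_le])
qed

text \<open>\<open>Poly\<close> recovers a polynomial from its list of coefficients, and there are
  finitely many lists of bounded length. This makes the uniform choice of a mask meaningful.\<close>

lemma finite_polys_degree_less: "finite {p :: 'a::{comm_semiring_0,finite} poly. degree p < n}"
proof (rule finite_subset)
  show "{p :: 'a poly. degree p < n} \<subseteq> Poly ` {xs. set xs \<subseteq> UNIV \<and> length xs \<le> n}"
  proof
    fix p :: "'a poly" assume "p \<in> {p. degree p < n}"
    then show "p \<in> Poly ` {xs. set xs \<subseteq> UNIV \<and> length xs \<le> n}"
      by (cases "p = 0") (auto intro!: image_eqI[of _ _ "coeffs p"] simp: length_coeffs_degree)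
  qed
qed (intro finite_imageI finite_lists_length_le, simp)

lemma finite_lists_of_length: "finite {xs :: 'a::finite list. length xs = n}"
  using finite_lists_length_eq[of "UNIV :: 'a set"] by simp

lemma card_lists_of_length: "card {xs :: 'a::finite list. length xs = n} = CARD('a) ^ n"
  using card_lists_length_eq[of "UNIV :: 'a set"] by simp

lemma degree_Poly_less: "length xs \<le> n \<Longrightarrow> 0 < n \<Longrightarrow> degree (Poly xs) < n"
  by (rule degree_lessI) (auto simp: nth_default_def)

section \<open>The threshold scheme of a system of field points\<close>

text \<open>The design after its points have become nonzero field elements. Blocks are lists, which
  fixes the order of the coordinates of a share; \<open>h j x\<close> is the player asked for the
  value at \<open>x\<close> when \<open>j\<close> has lost a share.\<close>

locale point_system =
  fixes k n d l1 t :: nat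
    and pts :: "nat \<Rightarrow> 'f::{field,finite} list"
    and h :: "nat \<Rightarrow> 'f \<Rightarrow> nat"
  assumes two_le_k: "2 \<le> k" and k_le_n: "k \<le> n" and t_pos: "0 < t" and d_pos: "0 < d"
    and distinct_pts: "\<And>j. j < n \<Longrightarrow> distinct (pts j)"
    and length_pts: "\<And>j. j < n \<Longrightarrow> length (pts j) = d"
    and nonzero_pts: "\<And>j. j < n \<Longrightarrow> 0 \<notin> set (pts j)"
    and card_union_ge: "\<And>A. A \<subseteq> {..<n} \<Longrightarrow> card A = k \<Longrightarrow> l1 + t \<le> card (\<Union>j\<in>A. set (pts j))"
    and card_union_le: "\<And>A. A \<subseteq> {..<n} \<Longrightarrow> card A = k - 1 \<Longrightarrow> card (\<Union>j\<in>A. set (pts j)) \<le> l1"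
    and helper: "\<And>j x. j < n \<Longrightarrow> x \<in> set (pts j) \<Longrightarrow> h j x \<in> {..<n} - {j} \<and> x \<in> set (pts (h j x))"
begin

definition secrets :: "'f list set" where
  "secrets = {xs. length xs = t}"

definition share_space :: "'f list set" where
  "share_space = {xs. length xs = d}"

definition masks :: "'f poly set" where
  "masks = {r. degree r < l1}"

definition dealt_poly :: "'f list \<Rightarrow> 'f poly \<Rightarrow> 'f poly" where
  "dealt_poly s r = Poly s + monom 1 t * r"

definition shares :: "'f poly \<Rightarrow> nat \<Rightarrow> 'f list" where
  "shares f = (\<lambda>j. map (poly f) (pts j))"

definition deal :: "'f list \<Rightarrow> (nat \<Rightarrow> 'f list) pmf" where
  "deal s = map_pmf (\<lambda>r. shares (dealt_poly s r)) (pmf_of_set masks)"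

text \<open>Since \<open>k - 1\<close> is positive, a union of \<open>k - 1\<close> blocks contains
  a whole block. This makes \<open>masks\<close> nonempty and later lets the values on one block be
  prescribed freely.\<close>

lemma d_le_l1: "d \<le> l1"
proof -
  have "set (pts 0) \<subseteq> (\<Union>j\<in>{..<k-1}. set (pts j))"
    using two_le_k by force
  then have "card (set (pts 0)) \<le> card (\<Union>j\<in>{..<k-1}. set (pts j))"
    by (intro card_mono) auto
  also have "\<dots> \<le> l1"
    using k_le_n by (intro card_union_le) auto
  finally show ?thesis
    using distinct_card[OF distinct_pts] length_pts two_le_k k_le_n by simp
qed

lemma l1_pos: "0 < l1"
  using d_le_l1 d_pos by simp

lemma finite_masks: "finite masks"
  unfolding masks_def by (rule finite_polys_degree_less)

lemma masks_nonempty: "masks \<noteq> {}"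
  using l1_pos unfolding masks_def by (metis degree_0 empty_iff mem_Collect_eq)

lemma set_pmf_deal: "set_pmf (deal s) = (\<lambda>r. shares (dealt_poly s r)) ` masks"
  unfolding deal_def using finite_masks masks_nonempty by simp

lemma degree_dealt_poly:
  assumes "s \<in> secrets" "r \<in> masks"
  shows "degree (dealt_poly s r) < l1 + t"
proof -
  have "degree (Poly s) < l1 + t"
    using assms t_pos by (intro degree_Poly_less) (auto simp: secrets_def)
  moreover have "degree (monom 1 t * r) < l1 + t"
    using assms l1_pos by (cases "r = 0") (auto simp: masks_def degree_mult_eq degree_monom_eq)
  ultimately show ?thesis
    unfolding dealt_poly_def by (rule degree_add_less)
qed

lemma coeff_dealt_poly:
  assumes "s \<in> secrets" "i < t"
  shows "coeff (dealt_poly s r) i = s ! i"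
  using assms by (simp add: dealt_poly_def coeff_monom_mult secrets_def nth_default_def)

text \<open>The lowest \<open>t\<close> coefficients are the secret and the shifted rest is the
  mask. This is what shows that every conceivable repair message really occurs.\<close>

lemma dealt_poly_surj:
  assumes "degree f < l1 + t"
  obtains s r where "s \<in> secrets" "r \<in> masks" "dealt_poly s r = f"
proof
  define s where "s = map (coeff f) [0..<t]"
  show "s \<in> secrets" by (simp add: s_def secrets_def)
  show "poly_shift t f \<in> masks"
    using assms l1_pos unfolding masks_def
    by (auto intro!: degree_lessI simp: coeff_poly_shift coeff_eq_0)
  show "dealt_poly s (poly_shift t f) = f"
    by (rule poly_eqI)
       (auto simp: dealt_poly_def s_def coeff_monom_mult coeff_poly_shift nth_default_def)
qed

text \<open>Two polynomials of degree below \<open>l1 + t\<close> that agree at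
  \<open>l1 + t\<close> or more points coincide, and the secret can be read off the low
  coefficients.\<close>

lemma secret_determined:
  assumes A: "A \<subseteq> {..<n}" "card A = k"
    and s: "s \<in> secrets" "r \<in> masks" and s': "s' \<in> secrets" "r' \<in> masks"
    and eq: "restrict (shares (dealt_poly s r)) A = restrict (shares (dealt_poly s' r')) A"
  shows "s = s'"
proof -
  have "dealt_poly s r = dealt_poly s' r'"
  proof (rule poly_eqI_degree)
    fix x assume "x \<in> (\<Union>j\<in>A. set (pts j))"
    then obtain j where j: "j \<in> A" "x \<in> set (pts j)" by blast
    with eq have "shares (dealt_poly s r) j = shares (dealt_poly s' r') j"
      by (metis restrict_apply')
    with j show "poly (dealt_poly s r) x = poly (dealt_poly s' r') x"
      by (simp add: shares_def)
  qed (use card_union_ge[OF A] degree_dealt_poly s s' in \<open>fastforce intro: less_le_trans\<close>)+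
  then show ?thesis
    using s s' coeff_dealt_poly by (metis (mono_tags) mem_Collect_eq nth_equalityI secrets_def)
qed

lemma deal_private:
  assumes A: "A \<subseteq> {..<n}" "card A = k - 1" and s: "s \<in> secrets" "s' \<in> secrets"
  shows "map_pmf (\<lambda>\<sigma>. restrict \<sigma> A) (deal s) = map_pmf (\<lambda>\<sigma>. restrict \<sigma> A) (deal s')"
proof -
  define E where "E = (\<Union>j\<in>A. set (pts j))"
  obtain g where "degree g \<le> card E - 1"
    and g: "\<And>x. x \<in> E \<Longrightarrow> poly g x = (poly (Poly s) x - poly (Poly s') x) / x ^ t"
    using interpolation_exists[of E "\<lambda>x. (poly (Poly s) x - poly (Poly s') x) / x ^ t"]
    by auto
  \<comment> \<open>If \<open>E\<close> is empty, truncated subtraction makes the bound 0, so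
    \<open>l1_pos\<close> is needed as well.\<close>
  then have deg: "degree g < l1"
    using card_union_le[OF A] l1_pos unfolding E_def by linarith
  \<comment> \<open>Translation by \<open>g\<close> permutes the masks, hence preserves their
    uniform distribution.\<close>
  have "bij_betw (\<lambda>r. r + g) masks masks"
    by (rule bij_betwI[where g = "\<lambda>r. r - g"])
       (use deg in \<open>auto simp: masks_def intro: degree_add_less degree_diff_less\<close>)
  then have shift: "map_pmf (\<lambda>r. r + g) (pmf_of_set masks) = pmf_of_set masks"
    using finite_masks masks_nonempty by (intro map_pmf_of_set_bij_betw)
  have "restrict (shares (dealt_poly s' (r + g))) A = restrict (shares (dealt_poly s r)) A" for r
  proof (rule restrict_ext)
    fix j assume j: "j \<in> A"
    have "poly (dealt_poly s' (r + g)) x = poly (dealt_poly s r) x" if "x \<in> set (pts j)" for x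
    proof -
      have "x \<in> E" "x \<noteq> 0"
        using that j A nonzero_pts[of j] by (auto simp: E_def)
      then show ?thesis
        by (simp add: dealt_poly_def poly_monom g distrib_left)
    qed
    then show "shares (dealt_poly s' (r + g)) j = shares (dealt_poly s r) j"
      by (simp add: shares_def)
  qed
  moreover have "deal s' = map_pmf (\<lambda>r. shares (dealt_poly s' (r + g))) (pmf_of_set masks)"
    unfolding deal_def by (subst shift[symmetric]) (simp add: pmf.map_comp o_def)
  ultimately show ?thesis
    by (simp add: deal_def pmf.map_comp o_def)
qed

text \<open>The pooled shares are compatible with one secret only, so the reconstruction may choose
  any compatible one.\<close>

lemma secret_recoverable:
  assumes A: "A \<subseteq> {..<n}" "card A = k"
  shows "\<exists>rec. \<forall>s\<in>secrets. \<forall>\<sigma>\<in>set_pmf (deal s). rec (restrict \<sigma> A) = s"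
proof (intro exI ballI)
  fix s \<sigma> assume s: "s \<in> secrets" "\<sigma> \<in> set_pmf (deal s)"
  show "(SOME s'. s' \<in> secrets \<and> (\<exists>\<sigma>'\<in>set_pmf (deal s'). restrict \<sigma>' A = restrict \<sigma> A)) = s"
  proof (rule some_equality)
    fix s' assume "s' \<in> secrets \<and> (\<exists>\<sigma>'\<in>set_pmf (deal s'). restrict \<sigma>' A = restrict \<sigma> A)"
    then obtain \<sigma>' where s': "s' \<in> secrets" "\<sigma>' \<in> set_pmf (deal s')"
      and eq: "restrict \<sigma>' A = restrict \<sigma> A" by blast
    obtain r where r: "r \<in> masks" "\<sigma> = shares (dealt_poly s r)"
      using s(2) unfolding set_pmf_deal by blast
    obtain r' where r': "r' \<in> masks" "\<sigma>' = shares (dealt_poly s' r')"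
      using s'(2) unfolding set_pmf_deal by blast
    show "s' = s"
      by (rule secret_determined[OF A s'(1) r'(1) s(1) r(1) eq[unfolded r(2) r'(2)]])
  qed (use s in blast)
qed

lemma threshold_scheme_deal: "threshold_scheme k n secrets share_space deal"
  unfolding threshold_scheme_def
proof (intro conjI)
  show "finite secrets" "finite share_space" "secrets \<noteq> {}"
    using Ex_list_of_length[of t]
    by (simp_all add: secrets_def share_space_def finite_lists_of_length)
  show "\<forall>s\<in>secrets. \<forall>\<sigma>\<in>set_pmf (deal s). \<forall>i<n. \<sigma> i \<in> share_space"
    by (simp add: share_space_def set_pmf_deal shares_def length_pts)
  show "\<forall>A\<subseteq>{..<n}. card A = k
      \<longrightarrow> (\<exists>rec. \<forall>s\<in>secrets. \<forall>\<sigma>\<in>set_pmf (deal s). rec (restrict \<sigma> A) = s)"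
    by (intro allI impI) (rule secret_recoverable)
  show "\<forall>A\<subseteq>{..<n}. card A = k - 1 \<longrightarrow> (\<forall>s\<in>secrets. \<forall>s'\<in>secrets.
      map_pmf (\<lambda>\<sigma>. restrict \<sigma> A) (deal s) = map_pmf (\<lambda>\<sigma>. restrict \<sigma> A) (deal s'))"
    by (intro allI impI ballI) (rule deal_private)
qed (fact two_le_k k_le_n)+

section \<open>The repair protocol and its security\<close>

text \<open>These lists are the fibres of \<open>h l\<close> on the block of \<open>l\<close>, so
  each lost value is requested exactly once.\<close>

definition asked :: "nat \<Rightarrow> nat \<Rightarrow> 'f list" where
  "asked l i = filter (\<lambda>x. h l x = i) (pts l)"

text \<open>A share stores values without their points, so \<open>xs\<close> supplies the points and
  the lookup goes through the zipped table.\<close>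

definition values_at :: "'f list \<Rightarrow> 'f list \<Rightarrow> 'f list \<Rightarrow> 'f list" where
  "values_at xs vs ys = map (\<lambda>y. the (map_of (zip xs vs) y)) ys"

definition protocol :: "nat \<Rightarrow> ('f list, 'f list, 'f list) repair_protocol" where
  "protocol l = \<lparr>
     helpers = h l ` set (pts l),
     coins = (\<lambda>_. return_pmf []),
     exch_pairs = {},
     exch_msg = (\<lambda>_ _ _ _. []),
     rep_msg = (\<lambda>i x _ _. values_at (pts i) x (asked l i)),
     recover = (\<lambda>w. map (\<lambda>y. hd (values_at (asked l (h l y)) (w (h l y)) [y])) (pts l))\<rparr>"

lemma exch_pairs_protocol: "exch_pairs (protocol l) = {}"
  by (simp add: protocol_def)

lemma values_at_map: "set ys \<subseteq> set xs \<Longrightarrow> values_at xs (map f xs) ys = map f ys"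
  by (auto simp: values_at_def map_of_zip_map)

lemma set_asked: "set (asked l i) = {x \<in> set (pts l). h l x = i}"
  by (auto simp: asked_def)

lemma distinct_asked: "l < n \<Longrightarrow> distinct (asked l i)"
  unfolding asked_def using distinct_pts by simp

lemma values_at_shares:
  assumes "l < n"
  shows "values_at (pts i) (shares f i) (asked l i) = map (poly f) (asked l i)"
  unfolding shares_def using helper[OF assms] by (intro values_at_map) (auto simp: set_asked)

lemma rep_transcript_shares:
  assumes "l < n"
  shows "rep_transcript (protocol l) (shares f) r
    = restrict (\<lambda>i. map (poly f) (asked l i)) (h l ` set (pts l))"
  using values_at_shares[OF assms] by (simp add: rep_transcript_def protocol_def)

text \<open>At most \<open>d\<close> values are requested from one helper and \<open>d\<close> is at
  most \<open>l1\<close>, so they can be prescribed arbitrarily by a dealt polynomial. The exact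
  message space is needed because bit-lengths are measured on the messages that occur.\<close>

lemma rep_space_protocol:
  assumes l: "l < n" and i: "i \<in> helpers (protocol l)"
  shows "rep_space secrets deal (protocol l) i = {xs. length xs = length (asked l i)}"
proof -
  have i': "i \<in> h l ` set (pts l)"
    using i by (simp add: protocol_def)
  have "\<exists>s\<in>secrets. \<exists>r\<in>masks. map (poly (dealt_poly s r)) (asked l i) = ys"
    if ys: "length ys = length (asked l i)" for ys
  proof -
    note dist = distinct_asked[OF l, of i]
    obtain f where f: "degree f \<le> card (set (asked l i)) - 1"
      "\<And>x. x \<in> set (asked l i) \<Longrightarrow> poly f x = the (map_of (zip (asked l i) ys) x)"
      using interpolation_exists[of "set (asked l i)" "\<lambda>x. the (map_of (zip (asked l i) ys) x)"]
      by auto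
    have "card (set (asked l i)) \<le> d"
      using distinct_card[OF dist] length_pts[OF l] by (metis asked_def length_filter_le)
    then have "degree f < l1 + t"
      using f(1) d_le_l1 t_pos by linarith
    then obtain s r where sr: "s \<in> secrets" "r \<in> masks" "dealt_poly s r = f"
      by (rule dealt_poly_surj)
    have "map (poly f) (asked l i) = ys"
      using ys dist by (intro nth_equalityI) (auto simp: f(2) map_of_zip_nth)
    with sr show ?thesis by blast
  qed
  then have surj: "(\<Union>s\<in>secrets. (\<lambda>r. map (poly (dealt_poly s r)) (asked l i)) ` masks)
      = {xs. length xs = length (asked l i)}"
    by (fastforce simp: image_iff)
  \<comment> \<open>The message depends on the shares alone, so projecting the execution to its
    first component yields the support of \<open>deal\<close>.\<close>
  have "(\<lambda>(\<sigma>, c). rep_transcript (protocol l) \<sigma> c i)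
      = (\<lambda>\<sigma>. values_at (pts i) (\<sigma> i) (asked l i)) \<circ> fst"
    using i' by (auto simp: rep_transcript_def protocol_def)
  then have "rep_space secrets deal (protocol l) i
      = (\<Union>s\<in>secrets. (\<lambda>\<sigma>. values_at (pts i) (\<sigma> i) (asked l i)) ` set_pmf (deal s))"
    by (simp only: rep_space_def execution_def set_pair_pmf image_comp[symmetric] fst_image_times
        set_pmf_not_empty if_False)
  also have "\<dots> = (\<Union>s\<in>secrets. (\<lambda>r. map (poly (dealt_poly s r)) (asked l i)) ` masks)"
    by (simp add: set_pmf_deal image_image values_at_shares[OF l])
  finally show ?thesis
    using surj by simp
qed

lemma sum_length_asked: "(\<Sum>i\<in>h l ` set (pts l). length (asked l i)) = length (pts l)"
  if "l < n"
proof -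
  have "length (asked l i) = card {x \<in> set (pts l). h l x = i}" for i
    using distinct_card[OF distinct_asked[OF that], of i] by (simp add: set_asked)
  then show ?thesis
    using sum.image_gen[of "set (pts l)" "\<lambda>_. 1::nat" "h l"] distinct_card[OF distinct_pts[OF that]]
    by simp
qed

text \<open>If \<open>l\<close> is in \<open>C\<close>, every repair message lists values already
  contained in the share of \<open>l\<close>; otherwise the visible messages are those sent by
  members of \<open>C\<close>, computed from their own shares. One map \<open>V\<close> serves all
  polynomials and coins.\<close>

lemma view_of_shares:
  assumes l: "l < n"
  shows "\<exists>V. \<forall>f r. view (protocol l) l C (shares f, r) = V (restrict (shares f) C)"
proof -
  \<comment> \<open>A member of \<open>C\<close>, for \<open>i\<close> in \<open>H\<close>, whose
    share contains all values sent by \<open>i\<close>.\<close>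
  define informant where "informant i = (if l \<in> C then l else i)" for i
  define H where "H = {i \<in> helpers (protocol l). i \<in> C \<or> l \<in> C}"
  define R where "R \<tau> = restrict (\<lambda>i. values_at (pts (informant i)) (\<tau> (informant i)) (asked l i)) H"
    for \<tau>
  have "restrict (rep_transcript (protocol l) (shares f) r) H = R (restrict (shares f) C)" for f r
    unfolding R_def
  proof (rule restrict_ext)
    fix i assume i: "i \<in> H"
    have "restrict (shares f) C (informant i) = map (poly f) (pts (informant i))"
      using i by (auto simp: shares_def informant_def H_def)
    moreover have "set (asked l i) \<subseteq> set (pts (informant i))"
      using helper[OF l] by (auto simp: set_asked informant_def)
    moreover have "i \<in> h l ` set (pts l)"
      using i by (simp add: H_def protocol_def)
    ultimately show "rep_transcript (protocol l) (shares f) r i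
        = values_at (pts (informant i)) (restrict (shares f) C (informant i)) (asked l i)"
      by (simp only: rep_transcript_shares[OF l] values_at_map restrict_apply' if_True)
  qed
  moreover have "restrict (exch_transcript (protocol l) \<sigma> r)
      {(i, j) \<in> exch_pairs (protocol l). i \<in> C \<or> j \<in> C} = (\<lambda>_. undefined)" for \<sigma> r
    by (simp add: exch_pairs_protocol restrict_def)
  ultimately have "view (protocol l) l C (shares f, r)
      = (\<lambda>\<tau>. (\<tau>, (\<lambda>_. undefined), R \<tau>)) (restrict (shares f) C)" for f r
    by (simp only: view_def prod.case H_def)
  then show ?thesis by (intro exI allI)
qed

lemma protocol_recovers:
  assumes l: "l < n"
  shows "recover (protocol l) (rep_transcript (protocol l) (shares f) r) = shares f l"
proof -
  have "values_at (asked l (h l y)) (map (poly f) (asked l (h l y))) [y] = [poly f y]"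
    if "y \<in> set (pts l)" for y
    using that by (subst values_at_map) (auto simp: set_asked)
  then show ?thesis
    unfolding rep_transcript_shares[OF l] by (simp add: protocol_def shares_def)
qed

text \<open>The view is the image of the coalition's shares under a fixed map, so privacy reduces to
  \<open>deal_private\<close>.\<close>

lemma view_private:
  assumes l: "l < n" and C: "C \<subseteq> {..<n}" "card C = k - 1" and s: "s \<in> secrets" "s' \<in> secrets"
  shows "map_pmf (view (protocol l) l C) (execution deal (protocol l) s)
    = map_pmf (view (protocol l) l C) (execution deal (protocol l) s')"
proof -
  from view_of_shares[OF l, of C]
  obtain V where V: "\<forall>f r. view (protocol l) l C (shares f, r) = V (restrict (shares f) C)" ..
  have eq: "map_pmf (view (protocol l) l C) (execution deal (protocol l) s)
      = map_pmf V (map_pmf (\<lambda>\<sigma>. restrict \<sigma> C) (deal s))" for s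
  proof -
    \<comment> \<open>The factorization through \<open>V\<close> is known only for vectors of the
      form \<open>shares f\<close>, so the two maps are compared on the support.\<close>
    have "view (protocol l) l C x = V (restrict (fst x) C)"
      if "x \<in> set_pmf (execution deal (protocol l) s)" for x
    proof -
      have "fst x \<in> set_pmf (deal s)"
        using that by (simp only: execution_def set_pair_pmf mem_Times_iff)
      then obtain f where "fst x = shares f"
        unfolding set_pmf_deal by (elim imageE)
      then show ?thesis using V by (metis prod.collapse)
    qed
    then have "map_pmf (view (protocol l) l C) (execution deal (protocol l) s)
        = map_pmf (\<lambda>x. V (restrict (fst x) C)) (execution deal (protocol l) s)"
      by (rule map_pmf_cong[OF refl])
    also have "\<dots> = map_pmf (\<lambda>\<sigma>. V (restrict \<sigma> C)) (map_pmf fst (execution deal (protocol l) s))"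
      by (simp only: pmf.map_comp o_def)
    also have "map_pmf fst (execution deal (protocol l) s) = deal s"
      by (simp add: execution_def map_fst_pair_pmf)
    finally show ?thesis
      by (simp only: pmf.map_comp o_def)
  qed
  show ?thesis
    by (simp only: eq deal_private[OF C s])
qed

lemma secure_protocol:
  assumes l: "l < n"
  shows "secure_repair_protocol k n secrets deal l (protocol l)"
  unfolding secure_repair_protocol_def
proof (intro conjI)
  show "helpers (protocol l) \<subseteq> {..<n} - {l}"
    using helper[OF l] by (auto simp: protocol_def)
  show "\<forall>i\<in>helpers (protocol l). finite (rep_space secrets deal (protocol l) i)"
    by (simp add: rep_space_protocol[OF l] finite_lists_of_length)
  show "\<forall>s\<in>secrets. \<forall>(\<sigma>, r)\<in>set_pmf (execution deal (protocol l) s).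
      recover (protocol l) (rep_transcript (protocol l) \<sigma> r) = \<sigma> l"
    by (auto simp: execution_def set_pmf_deal protocol_recovers[OF l])
  show "\<forall>C\<subseteq>{..<n}. card C = k - 1 \<longrightarrow> (\<forall>s\<in>secrets. \<forall>s'\<in>secrets.
      map_pmf (view (protocol l) l C) (execution deal (protocol l) s)
        = map_pmf (view (protocol l) l C) (execution deal (protocol l) s'))"
    by (intro allI impI ballI) (rule view_private[OF l])
qed (simp_all add: exch_pairs_protocol)

lemma restricted_RTS_deal: "restricted_RTS k n d secrets share_space deal protocol"
proof -
  have "card (helpers (protocol l)) \<le> d" if "l < n" for l
    using card_image_le[of "set (pts l)" "h l"] card_length[of "pts l"] length_pts[OF that]
    by (simp add: protocol_def)
  then show ?thesis
    by (simp add: restricted_RTS_def threshold_scheme_deal secure_protocol)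
qed

section \<open>Information rate and communication complexity\<close>

text \<open>A field has the two elements 0 and 1. This allows the common factor to be cancelled in
  both quotients of logarithms.\<close>

lemma log_card_field_nonzero: "log 2 (real CARD('f)) \<noteq> 0"
proof -
  have "card {0 :: 'f, 1} \<le> CARD('f)" by (rule card_mono) simp_all
  then have "1 < real CARD('f)" by simp
  then have "0 < log 2 (real CARD('f))"
    by (rule zero_less_log_cancel_iff[THEN iffD2, rotated 2]) auto
  then show ?thesis by (rule less_imp_neq[THEN not_sym])
qed

lemma log_card_lists:
  "log 2 (real (card {xs :: 'f list. length xs = j})) = real j * log 2 (real CARD('f))"
  by (simp add: card_lists_of_length log_nat_power)

lemma information_rate_deal: "information_rate secrets share_space = real t / real d"
  by (simp add: information_rate_def secrets_def share_space_def log_card_lists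
      log_card_field_nonzero)

text \<open>The requested lists partition the block of \<open>l\<close>, so exactly \<open>d\<close>
  field elements are sent in total, against \<open>t\<close> for the secret.\<close>

lemma communication_complexity_protocol:
  assumes l: "l < n"
  shows "communication_complexity secrets deal (protocol l) = real d / real t"
proof -
  have "(\<Sum>i\<in>helpers (protocol l). log 2 (real (card (rep_space secrets deal (protocol l) i))))
      = (\<Sum>i\<in>helpers (protocol l). real (length (asked l i)) * log 2 (real CARD('f)))"
    by (intro sum.cong refl) (simp add: rep_space_protocol[OF l] log_card_lists)
  also have "\<dots> = real (\<Sum>i\<in>helpers (protocol l). length (asked l i)) * log 2 (real CARD('f))"
    by (simp add: sum_distrib_right)
  also have "(\<Sum>i\<in>helpers (protocol l). length (asked l i)) = d"
    using sum_length_asked[OF l] length_pts[OF l] by (simp add: protocol_def)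
  finally have "(\<Sum>i\<in>helpers (protocol l). log 2 (real (card (rep_space secrets deal (protocol l) i))))
      = real d * log 2 (real CARD('f))" .
  moreover have "log 2 (real (card secrets)) = real t * log 2 (real CARD('f))"
    unfolding secrets_def by (rule log_card_lists)
  ultimately show ?thesis
    unfolding communication_complexity_def by (simp add: exch_pairs_protocol log_card_field_nonzero)
qed

end

section \<open>From distribution designs to point systems\<close>

theorem theorem4p2:
  fixes X :: "'p set" and B :: "nat \<Rightarrow> 'p set"
    and k m b d s n Q :: nat and l1 l2 :: int
  assumes "distribution_design k l1 l2 X B b d"
    and "card X = m"
    and "primepow Q"
    and "CARD('f::{field,finite}) = Q"
    and "Q \<ge> m + 1"
    and "\<exists>I. basic_repairing_set X B b s I"
    and "s \<le> n" and "n \<le> b"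
  shows "\<exists>(K :: 'f list set) (S :: 'f list set) (deal :: 'f list \<Rightarrow> (nat \<Rightarrow> 'f list) pmf)
            (P :: nat \<Rightarrow> ('f list, 'f list, 'f list) repair_protocol).
           S = {x. length x = d} \<and>
           restricted_RTS k n d K S deal P \<and>
           information_rate K S = real_of_int (l2 - l1) / real d \<and>
           (\<forall>l<n. communication_complexity K deal (P l) = real d / real_of_int (l2 - l1))"
proof -
  have X: "finite X" and B: "\<And>i. i < b \<Longrightarrow> B i \<subseteq> X \<and> card (B i) = d"
    and k: "2 \<le> k" "k \<le> b" and l12: "l1 < l2"
    and union_ge: "\<And>I. I \<subseteq> {..<b} \<Longrightarrow> card I = k \<Longrightarrow> l2 \<le> int (card (\<Union>i\<in>I. B i))"
    and union_le: "\<And>I. I \<subseteq> {..<b} \<Longrightarrow> card I = k - 1 \<Longrightarrow> int (card (\<Union>i\<in>I. B i)) \<le> l1"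
    using assms(1) by (auto simp: distribution_design_def design_def)
  have union_subset: "(\<Union>i\<in>A. B i) \<subseteq> X" if "A \<subseteq> {..<b}" for A
    using that B by blast
  obtain I where I: "I \<subseteq> {..<b}" "card I = s"
    and repairs: "\<And>x. x \<in> X \<Longrightarrow> 2 \<le> card {i\<in>I. x \<in> B i}"
    using assms(6) by (auto simp: basic_repairing_set_def)
  have other: "\<exists>i\<in>I. i \<noteq> j \<and> x \<in> B i" if "x \<in> X" for x j
  proof (rule ccontr)
    assume "\<not> ?thesis"
    then have "card {i\<in>I. x \<in> B i} \<le> card {j}" by (intro card_mono) auto
    with repairs[OF that] show False by simp
  qed
  have "{..<k-1} \<subseteq> {..<b}" "card {..<k-1} = k - 1"
    using k by auto
  \<comment> \<open>A cardinality is bounded by \<open>l1\<close>, so the integer \<open>l1\<close>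
    may be replaced by \<open>nat l1\<close>.\<close>
  from union_le[OF this] have l1: "0 \<le> l1" by linarith
  have l2: "l2 \<le> int (card (\<Union>i<k. B i))"
    using union_ge[of "{..<k}"] k by simp
  have "0 < d"
  proof (rule ccontr)
    assume "\<not> 0 < d"
    then have "B i = {}" if "i < b" for i
      using B[OF that] finite_subset[OF _ X] by auto
    then have "(\<Union>i<k. B i) = {}" using k by auto
    then show False using l1 l2 l12 by simp
  qed
  \<comment> \<open>A repairing set covers \<open>X\<close>, which \<open>k - 1\<close> blocks cannot.\<close>
  have "k \<le> s"
  proof (rule ccontr)
    assume "\<not> k \<le> s"
    then have "card I \<le> k - 1" "k - 1 \<le> card {..<b}" using I k by auto
    then obtain J where J: "I \<subseteq> J" "J \<subseteq> {..<b}" "card J = k - 1"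
      using exists_subset_between[of I "k - 1" "{..<b}"] I(1) by blast
    have "(\<Union>i<k. B i) \<subseteq> X" "(\<Union>i\<in>J. B i) \<subseteq> X"
      using union_subset[of "{..<k}"] union_subset[OF J(2)] k by simp_all
    moreover have "X \<subseteq> (\<Union>i\<in>J. B i)"
      using other J(1) by blast
    ultimately have "card (\<Union>i<k. B i) \<le> card (\<Union>i\<in>J. B i)"
      using X by (metis card_mono subset_antisym)
    then show False using union_le[OF J(2,3)] l2 l12 by linarith
  qed
  have "card I \<le> n" "n \<le> card {..<b}" using I assms(7,8) by auto
  \<comment> \<open>The \<open>n\<close> blocks used are chosen around the repairing set, so that
    all helpers are among the players.\<close>
  then obtain J where J: "I \<subseteq> J" "J \<subseteq> {..<b}" "card J = n"
    using exists_subset_between[of I n "{..<b}"] I(1) by blast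
  obtain \<pi> where "bij_betw \<pi> {0..<n} J"
    using ex_bij_betw_nat_finite[of J] J finite_subset[OF J(2)] by auto
  then have \<pi>: "inj_on \<pi> {..<n}" "\<pi> ` {..<n} = J"
    by (auto simp: bij_betw_def atLeast0LessThan)
  have \<pi>_less: "\<pi> j < b" if "j < n" for j
    using that \<pi>(2) J by blast
  have "card X \<le> card (UNIV - {0 :: 'f})"
    using assms by simp
  \<comment> \<open>The field has at least \<open>m\<close> nonzero elements, so the points embed
    into them.\<close>
  then obtain \<alpha> :: "'p \<Rightarrow> 'f" where \<alpha>: "inj_on \<alpha> X" "\<alpha> ` X \<subseteq> UNIV - {0}"
    using inj_on_iff_card_le[OF X, of "UNIV - {0 :: 'f}"] by auto
  define pts where "pts j = (SOME xs. distinct xs \<and> set xs = \<alpha> ` B (\<pi> j))" for j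
  have pts: "distinct (pts j)" "set (pts j) = \<alpha> ` B (\<pi> j)" if "j < n" for j
  proof -
    have "finite (\<alpha> ` B (\<pi> j))"
      using B[OF \<pi>_less[OF that]] finite_subset[OF _ X] by blast
    then have "\<exists>xs. distinct xs \<and> set xs = \<alpha> ` B (\<pi> j)"
      using finite_distinct_list by blast
    from someI_ex[OF this] show "distinct (pts j)" "set (pts j) = \<alpha> ` B (\<pi> j)"
      unfolding pts_def by blast+
  qed
  define h where "h j x = (SOME i. i < n \<and> i \<noteq> j \<and> x \<in> set (pts i))" for j x
  \<comment> \<open>Injectivity of \<pi> keeps the number of block indices, and that of \<alpha> on
    \<open>X\<close> keeps the sizes of unions, so both design bounds carry over.\<close>
  have card_union: "card (\<Union>j\<in>A. set (pts j)) = card (\<Union>i\<in>\<pi> ` A. B i)"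
    and \<pi>_image: "\<pi> ` A \<subseteq> {..<b}" "card (\<pi> ` A) = card A" if "A \<subseteq> {..<n}" for A
  proof -
    show sub: "\<pi> ` A \<subseteq> {..<b}" using that \<pi>_less by blast
    show "card (\<pi> ` A) = card A" by (rule card_image[OF inj_on_subset[OF \<pi>(1) that]])
    have "(\<Union>j\<in>A. set (pts j)) = (\<Union>j\<in>A. \<alpha> ` B (\<pi> j))"
      by (rule SUP_cong[OF refl], rule pts(2)) (use that in auto)
    also have "\<dots> = \<alpha> ` (\<Union>i\<in>\<pi> ` A. B i)"
      by (simp add: image_UN)
    finally show "card (\<Union>j\<in>A. set (pts j)) = card (\<Union>i\<in>\<pi> ` A. B i)"
      by (simp only: card_image[OF inj_on_subset[OF \<alpha>(1) union_subset[OF sub]]])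
  qed
  interpret point_system k n d "nat l1" "nat (l2 - l1)" pts h
  proof
    fix j assume j: "j < n"
    have Bj: "B (\<pi> j) \<subseteq> X" "card (B (\<pi> j)) = d" using B[OF \<pi>_less[OF j]] by auto
    show "distinct (pts j)" by (rule pts(1)[OF j])
    show "length (pts j) = d"
      using distinct_card[OF pts(1)[OF j]] Bj card_image[OF inj_on_subset[OF \<alpha>(1) Bj(1)]]
      by (simp add: pts(2)[OF j])
    show "0 \<notin> set (pts j)" using Bj(1) \<alpha>(2) pts(2)[OF j] by auto
    fix x assume "x \<in> set (pts j)"
    then obtain y where y: "y \<in> X" "x = \<alpha> y" using Bj(1) pts(2)[OF j] by auto
    \<comment> \<open>Taking \<open>i\<close> different from \<open>\<pi> j\<close> ensures that the
      player with block \<open>i\<close> is not \<open>j\<close>.\<close>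
    then obtain i where i: "i \<in> I" "i \<noteq> \<pi> j" "y \<in> B i" using other by blast
    then obtain j' where "j' < n" "i = \<pi> j'" using J(1) \<pi>(2) by blast
    then have "\<exists>i. i < n \<and> i \<noteq> j \<and> x \<in> set (pts i)" using i y pts(2) by auto
    then show "h j x \<in> {..<n} - {j} \<and> x \<in> set (pts (h j x))"
      unfolding h_def by (rule someI2_ex) auto
  next
    fix A assume A: "A \<subseteq> {..<n}"
    show "nat l1 + nat (l2 - l1) \<le> card (\<Union>j\<in>A. set (pts j))" if "card A = k"
      using union_ge[of "\<pi> ` A"] \<pi>_image[OF A] card_union[OF A] that l1 l12 by simp
    show "card (\<Union>j\<in>A. set (pts j)) \<le> nat l1" if "card A = k - 1"
      using union_le[of "\<pi> ` A"] \<pi>_image[OF A] card_union[OF A] that by simp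
  qed (use k \<open>k \<le> s\<close> assms(7) l12 \<open>0 < d\<close> in auto)
  show ?thesis
    using restricted_RTS_deal information_rate_deal communication_complexity_protocol l12
    by (intro exI[of _ secrets] exI[of _ share_space] exI[of _ deal] exI[of _ protocol])
       (simp add: share_space_def)
qed

end
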